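(* Let $n\geq 3$ be a positive integer and let $R\cong \prod_{i=1}^{n}\mathbb{F}_{i}$, where $\mathbb{F}_{i}$ is a field for every $1\leq i\leq n$. Then the following statements hold: 1) If $n\leq 4$, then $\dim_M(In(R))=n-1$. 2) If $n\geq 5$, then $\dim_M(In(R))=n$.
   Context: For a commutative ring $R$ with identity, the inclusion ideal graph $In(R)$ is the simple graph whose vertices are all non-trivial ideals of $R$ (ideals different from $0$ and $R$), two distinct vertices being adjacent if and only if one of them is properly contained in the other. For a graph $G$, $d(x,y)$ denotes the distance between vertices. For an ordered set $S=\{v_1,\dots,v_k\}\subseteq V(G)$ and $v\in V(G)\setminus S$, the representation vector of $v$ is $D(v|S)=(d(v,v_1),\dots,d(v,v_k))$. $S$ is resolving if distinct vertices outside $S$ have different representation vectors with respect to $S$. The metric dimension $\dim_M(G)$ is the minimum cardinality of a resolving set. *)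

theory Defs
  imports
    "HOL-Algebra.Chinese_Remainder"
    "Graph_Theory.Graph_Theory"
    "HOL-Library.Extended_Nat"
begin

definition nontrivial_ideals :: "('a, 'm) ring_scheme \<Rightarrow> 'a set set"
  where "nontrivial_ideals R = {I. ideal I R \<and> I \<noteq> {\<zero>\<^bsub>R\<^esub>} \<and> I \<noteq> carrier R}"

text \<open>
  A simple undirected graph is represented, as is customary for \<open>Graph_Theory\<close>, by a symmetric
  irreflexive set of arcs.
\<close>

definition inclusion_ideal_graph :: "('a, 'm) ring_scheme \<Rightarrow> 'a set pair_pre_digraph"
  where "inclusion_ideal_graph R =
    \<lparr> pverts = nontrivial_ideals R,
      parcs = {(I, J). I \<in> nontrivial_ideals R \<and> J \<in> nontrivial_ideals R \<and> (I \<subset> J \<or> J \<subset> I)} \<rparr>"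

lemma pair_bidirected_digraph_inclusion_ideal_graph:
  "pair_bidirected_digraph (inclusion_ideal_graph R)"
  by unfold_locales (auto simp: inclusion_ideal_graph_def symmetric_def intro!: symI)

text \<open>
  With every arc of cost 1, the cost of a walk is its length, so the infimum of the costs is the
  graph distance (infinite between different components).
\<close>

definition graph_dist :: "('a, 'b) pre_digraph \<Rightarrow> 'a \<Rightarrow> 'a \<Rightarrow> ereal"
  where "graph_dist G u v = wf_digraph.\<mu> G (\<lambda>_. 1) u v"

definition representation_vector :: "('a, 'b) pre_digraph \<Rightarrow> 'a \<Rightarrow> 'a list \<Rightarrow> ereal list"
  where "representation_vector G v S = map (graph_dist G v) S"

text \<open>
  The ordered set \<open>S\<close> is a list without repetitions. Only vertices outside \<open>S\<close> have to be
  distinguished.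
\<close>

definition resolving :: "('a, 'b) pre_digraph \<Rightarrow> 'a list \<Rightarrow> bool"
  where "resolving G S \<longleftrightarrow> distinct S \<and> set S \<subseteq> verts G \<and>
    (\<forall>u \<in> verts G - set S. \<forall>v \<in> verts G - set S.
      u \<noteq> v \<longrightarrow> representation_vector G u S \<noteq> representation_vector G v S)"

text \<open>
  The value is \<open>\<infinity>\<close> when there is no finite resolving set; otherwise the infimum is a minimum.
\<close>

definition metric_dimension :: "('a, 'b) pre_digraph \<Rightarrow> enat"
  where "metric_dimension G = (INF S \<in> {S. resolving G S}. enat (length S))"

end

theory Submission
  imports Defs
begin

text \<open>
  The ideals of a product of \<open>n\<close> fields correspond to the subsets of the index set: an ideal is
  determined by the coordinates that do not vanish identically on it. In the inclusion graph of the
  proper nonempty subsets, distinct comparable sets have distance 1, complementary sets have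
  distance 3, and all other pairs have distance 2.

  For the lower bound, a set outside a resolving set \<open>S\<close> of size \<open>k\<close> either is the complement of a
  member of \<open>S\<close> or has a representation vector over \<open>{1, 2}\<close>. Hence
  \<open>2 ^ n - 2 \<le> 2 ^ k + 2 * k\<close>, which excludes all smaller \<open>k\<close> in both cases of the theorem.

  For the upper bound, the distance to \<open>{i}\<close> tells whether \<open>i\<close> is a member, so the \<open>n\<close> singletons
  resolve the graph. If \<open>n \<le> 4\<close>, the last singleton can be omitted: if two non-singletons differ only
  in the last element, then the larger one is the complement of some remaining \<open>{i}\<close>, at distance 3,
  whereas the smaller one has distance 2 to \<open>{i}\<close>.
\<close>

section \<open>Ideals of a finite product of fields\<close>

text \<open>Prepending an entry is a ring isomorphism from the binary product of the head ring with
  the product of the tail. Pulled back along it, an entry is either the first projection or, by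
  induction, an entry of the second component.\<close>

lemma RDirProd_list_nth_hom:
  assumes "i < length Rs"
  shows "(\<lambda>xs. xs ! i) \<in> ring_hom (RDirProd_list Rs) (Rs ! i)"
  using assms
proof (induct Rs arbitrary: i)
  case (Cons R Rs)
  let ?c = "\<lambda>(a, as). a # as"
  let ?P = "RDirProd R (RDirProd_list Rs)"
  have iso: "?c \<in> ring_iso ?P (RDirProd_list (R # Rs))"
    by (rule RDirProd_list_iso1)
  have proj: "(\<lambda>x. ?c x ! i) \<in> ring_hom ?P ((R # Rs) ! i)"
  proof (cases i)
    case 0
    then show ?thesis
      by (auto simp: ring_hom_def RDirProd_def DirProd_def monoid.defs split: prod.splits)
  next
    case (Suc j)
    with Cons have "(\<lambda>xs. xs ! j) \<in> ring_hom (RDirProd_list Rs) (Rs ! j)" by simp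
    with Suc show ?thesis
      by (auto simp: ring_hom_def RDirProd_def DirProd_def monoid.defs split: prod.splits)
  qed
  show ?case
  proof (rule ring_hom_memI)
    fix x y
    assume x: "x \<in> carrier (RDirProd_list (R # Rs))" and y: "y \<in> carrier (RDirProd_list (R # Rs))"
    from iso have "?c ` carrier ?P = carrier (RDirProd_list (R # Rs))"
      by (auto simp: ring_iso_def bij_betw_def)
    with x y obtain u v where u: "u \<in> carrier ?P" "x = ?c u" and v: "v \<in> carrier ?P" "y = ?c v"
      by (metis (no_types, lifting) imageE)
    have hom: "?c \<in> ring_hom ?P (RDirProd_list (R # Rs))"
      using iso by (simp add: ring_iso_def)
    show "x ! i \<in> carrier ((R # Rs) ! i)"
      using ring_hom_closed[OF proj u(1)] u(2) by simp
    show "(x \<otimes>\<^bsub>RDirProd_list (R # Rs)\<^esub> y) ! i = x ! i \<otimes>\<^bsub>(R # Rs) ! i\<^esub> y ! i"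
      using ring_hom_mult[OF proj u(1) v(1)] ring_hom_mult[OF hom u(1) v(1)] u(2) v(2) by simp
    show "(x \<oplus>\<^bsub>RDirProd_list (R # Rs)\<^esub> y) ! i = x ! i \<oplus>\<^bsub>(R # Rs) ! i\<^esub> y ! i"
      using ring_hom_add[OF proj u(1) v(1)] ring_hom_add[OF hom u(1) v(1)] u(2) v(2) by simp
  next
    have hom: "?c \<in> ring_hom ?P (RDirProd_list (R # Rs))"
      using iso by (simp add: ring_iso_def)
    show "\<one>\<^bsub>RDirProd_list (R # Rs)\<^esub> ! i = \<one>\<^bsub>(R # Rs) ! i\<^esub>"
      using ring_hom_one[OF proj] ring_hom_one[OF hom] by simp
  qed
qed simp

text \<open>The product is described only through its projections: \<open>proj_surj\<close> and
  \<open>proj_inj\<close> make the joint map into the product of the \<open>F i\<close> bijective,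
  so the ideal theory below never touches the list representation.\<close>

locale field_product = cring R for R :: "('a, 'm) ring_scheme" (structure) +
  fixes n :: nat and F :: "nat \<Rightarrow> ('f, 'k) ring_scheme" and p :: "nat \<Rightarrow> 'a \<Rightarrow> 'f"
  assumes field: "i < n \<Longrightarrow> field (F i)"
    and proj_hom: "i < n \<Longrightarrow> p i \<in> ring_hom R (F i)"
    and proj_surj: "(\<And>i. i < n \<Longrightarrow> f i \<in> carrier (F i)) \<Longrightarrow> \<exists>x\<in>carrier R. \<forall>i<n. p i x = f i"
    and proj_inj: "x \<in> carrier R \<Longrightarrow> y \<in> carrier R \<Longrightarrow> (\<And>i. i < n \<Longrightarrow> p i x = p i y) \<Longrightarrow> x = y"
begin

lemma ring_hom_proj: "i < n \<Longrightarrow> ring_hom_ring R (F i) (p i)"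
  by (rule ring_hom_ringI2)
    (auto intro: ring_axioms proj_hom cring.axioms(1) domain.axioms(1) field.axioms(1) field)

lemma proj_simps:
  assumes "i < n"
  shows "x \<in> carrier R \<Longrightarrow> p i x \<in> carrier (F i)"
    and "p i \<zero> = \<zero>\<^bsub>F i\<^esub>"
    and "p i \<one> = \<one>\<^bsub>F i\<^esub>"
    and "x \<in> carrier R \<Longrightarrow> y \<in> carrier R \<Longrightarrow> p i (x \<oplus> y) = p i x \<oplus>\<^bsub>F i\<^esub> p i y"
    and "x \<in> carrier R \<Longrightarrow> y \<in> carrier R \<Longrightarrow> p i (x \<otimes> y) = p i x \<otimes>\<^bsub>F i\<^esub> p i y"
    and "x \<in> carrier R \<Longrightarrow> p i (\<ominus> x) = \<ominus>\<^bsub>F i\<^esub> p i x"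
proof -
  interpret ring_hom_ring R "F i" "p i" by (rule ring_hom_proj[OF assms])
  show "x \<in> carrier R \<Longrightarrow> p i x \<in> carrier (F i)" "p i \<zero> = \<zero>\<^bsub>F i\<^esub>" "p i \<one> = \<one>\<^bsub>F i\<^esub>"
    "x \<in> carrier R \<Longrightarrow> y \<in> carrier R \<Longrightarrow> p i (x \<oplus> y) = p i x \<oplus>\<^bsub>F i\<^esub> p i y"
    "x \<in> carrier R \<Longrightarrow> y \<in> carrier R \<Longrightarrow> p i (x \<otimes> y) = p i x \<otimes>\<^bsub>F i\<^esub> p i y"
    "x \<in> carrier R \<Longrightarrow> p i (\<ominus> x) = \<ominus>\<^bsub>F i\<^esub> p i x"
    by simp_all
qed

lemma comp_ring: "i < n \<Longrightarrow> ring (F i)"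
  by (intro cring.axioms(1) domain.axioms(1) field.axioms(1) field)

lemma comp_simps:
  assumes "i < n"
  shows "\<zero>\<^bsub>F i\<^esub> \<in> carrier (F i)" and "\<one>\<^bsub>F i\<^esub> \<in> carrier (F i)"
    and "\<ominus>\<^bsub>F i\<^esub> \<zero>\<^bsub>F i\<^esub> = \<zero>\<^bsub>F i\<^esub>"
    and "a \<in> carrier (F i) \<Longrightarrow> \<zero>\<^bsub>F i\<^esub> \<oplus>\<^bsub>F i\<^esub> a = a"
    and "a \<in> carrier (F i) \<Longrightarrow> a \<oplus>\<^bsub>F i\<^esub> \<zero>\<^bsub>F i\<^esub> = a"
    and "a \<in> carrier (F i) \<Longrightarrow> \<zero>\<^bsub>F i\<^esub> \<otimes>\<^bsub>F i\<^esub> a = \<zero>\<^bsub>F i\<^esub>"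
    and "a \<in> carrier (F i) \<Longrightarrow> a \<otimes>\<^bsub>F i\<^esub> \<zero>\<^bsub>F i\<^esub> = \<zero>\<^bsub>F i\<^esub>"
    and "a \<in> carrier (F i) \<Longrightarrow> a \<otimes>\<^bsub>F i\<^esub> \<one>\<^bsub>F i\<^esub> = a"
proof -
  interpret F: ring "F i" by (rule comp_ring[OF assms])
  show "\<zero>\<^bsub>F i\<^esub> \<in> carrier (F i)" "\<one>\<^bsub>F i\<^esub> \<in> carrier (F i)"
    "\<ominus>\<^bsub>F i\<^esub> \<zero>\<^bsub>F i\<^esub> = \<zero>\<^bsub>F i\<^esub>"
    "a \<in> carrier (F i) \<Longrightarrow> \<zero>\<^bsub>F i\<^esub> \<oplus>\<^bsub>F i\<^esub> a = a"
    "a \<in> carrier (F i) \<Longrightarrow> a \<oplus>\<^bsub>F i\<^esub> \<zero>\<^bsub>F i\<^esub> = a"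
    "a \<in> carrier (F i) \<Longrightarrow> \<zero>\<^bsub>F i\<^esub> \<otimes>\<^bsub>F i\<^esub> a = \<zero>\<^bsub>F i\<^esub>"
    "a \<in> carrier (F i) \<Longrightarrow> a \<otimes>\<^bsub>F i\<^esub> \<zero>\<^bsub>F i\<^esub> = \<zero>\<^bsub>F i\<^esub>"
    "a \<in> carrier (F i) \<Longrightarrow> a \<otimes>\<^bsub>F i\<^esub> \<one>\<^bsub>F i\<^esub> = a"
    by simp_all
qed

definition coord_ideal :: "nat set \<Rightarrow> 'a set"
  where "coord_ideal A = {x \<in> carrier R. \<forall>i<n. i \<notin> A \<longrightarrow> p i x = \<zero>\<^bsub>F i\<^esub>}"

text \<open>The idempotent with support \<open>A\<close>. A candidate exists by
  \<open>proj_surj\<close> and is unique by \<open>proj_inj\<close>.\<close>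

definition idem :: "nat set \<Rightarrow> 'a"
  where "idem A = (SOME x. x \<in> carrier R \<and>
    (\<forall>i<n. p i x = (if i \<in> A then \<one>\<^bsub>F i\<^esub> else \<zero>\<^bsub>F i\<^esub>)))"

lemma idem:
  shows idem_closed: "idem A \<in> carrier R"
    and proj_idem: "i < n \<Longrightarrow> p i (idem A) = (if i \<in> A then \<one>\<^bsub>F i\<^esub> else \<zero>\<^bsub>F i\<^esub>)"
proof -
  have "\<exists>x. x \<in> carrier R \<and> (\<forall>i<n. p i x = (if i \<in> A then \<one>\<^bsub>F i\<^esub> else \<zero>\<^bsub>F i\<^esub>))"
    unfolding Bex_def[symmetric] by (rule proj_surj) (auto simp: comp_simps)
  then have "idem A \<in> carrier R \<and>
    (\<forall>i<n. p i (idem A) = (if i \<in> A then \<one>\<^bsub>F i\<^esub> else \<zero>\<^bsub>F i\<^esub>))"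
    unfolding idem_def by (rule someI_ex)
  then show "idem A \<in> carrier R"
    "i < n \<Longrightarrow> p i (idem A) = (if i \<in> A then \<one>\<^bsub>F i\<^esub> else \<zero>\<^bsub>F i\<^esub>)"
    by auto
qed

lemma ideal_coord_ideal: "ideal (coord_ideal A) R"
proof (rule idealI)
  show "subgroup (coord_ideal A) (add_monoid R)"
  proof (rule add.subgroupI)
    have "\<zero> \<in> coord_ideal A" by (auto simp: coord_ideal_def proj_simps)
    then show "coord_ideal A \<noteq> {}" by blast
    show "\<And>a. a \<in> coord_ideal A \<Longrightarrow> \<ominus> a \<in> coord_ideal A"
      by (auto simp: coord_ideal_def proj_simps comp_simps)
    show "\<And>a b. a \<in> coord_ideal A \<Longrightarrow> b \<in> coord_ideal A \<Longrightarrow> a \<oplus> b \<in> coord_ideal A"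
      by (auto simp: coord_ideal_def proj_simps comp_simps)
  qed (auto simp: coord_ideal_def)
  show "\<And>a x. a \<in> coord_ideal A \<Longrightarrow> x \<in> carrier R \<Longrightarrow> x \<otimes> a \<in> coord_ideal A"
    "\<And>a x. a \<in> coord_ideal A \<Longrightarrow> x \<in> carrier R \<Longrightarrow> a \<otimes> x \<in> coord_ideal A"
    by (auto simp: coord_ideal_def proj_simps comp_simps)
qed (rule ring_axioms)

text \<open>The element \<open>idem A\<close> is the test: it lies in \<open>coord_ideal A\<close>,
  and since 1 differs from 0 in each field, it lies in \<open>coord_ideal B\<close> only if
  \<open>B\<close> contains \<open>A\<close>. Restricting \<open>A\<close> to indices below
  \<open>n\<close> matters because \<open>coord_ideal\<close> ignores all others.\<close>

lemma coord_ideal_subset_iff: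
  assumes "A \<subseteq> {..<n}"
  shows "coord_ideal A \<subseteq> coord_ideal B \<longleftrightarrow> A \<subseteq> B"
proof
  assume sub: "coord_ideal A \<subseteq> coord_ideal B"
  have "idem A \<in> coord_ideal A" by (simp add: coord_ideal_def idem)
  with sub have "idem A \<in> coord_ideal B" by blast
  moreover have "\<one>\<^bsub>F i\<^esub> \<noteq> \<zero>\<^bsub>F i\<^esub>" if "i < n" for i
    using domain.one_not_zero field.axioms(1) field that by metis
  ultimately show "A \<subseteq> B" using assms by (fastforce simp: coord_ideal_def idem)
qed (auto simp: coord_ideal_def)

text \<open>If some \<open>x\<close> in \<open>J\<close> is nonzero at \<open>i\<close>, multiplying
  it by the element that is the inverse of \<open>p i x\<close> at \<open>i\<close> and 0 elsewhere
  yields \<open>idem {i}\<close>. Sums of these over \<open>i\<close> in \<open>A\<close> give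
  \<open>idem A\<close>.\<close>

lemma idem_mem_ideal:
  assumes J: "ideal J R" and A: "A \<subseteq> {i. i < n \<and> (\<exists>x\<in>J. p i x \<noteq> \<zero>\<^bsub>F i\<^esub>)}"
  shows "idem A \<in> J"
proof -
  have "finite A" using A by (rule finite_subset) simp
  then show ?thesis using A
  proof (induct A rule: finite_induct)
    case empty
    have "idem {} = \<zero>" by (rule proj_inj) (auto simp: idem proj_simps)
    then show ?case using additive_subgroup.zero_closed[OF ideal.axioms(1)[OF J]] by simp
  next
    case (insert i A)
    then obtain x where i: "i < n" and x: "x \<in> J" "p i x \<noteq> \<zero>\<^bsub>F i\<^esub>" by auto
    have xR: "x \<in> carrier R" using ideal.Icarr[OF J x(1)] .
    have inv: "inv\<^bsub>F i\<^esub> p i x \<in> carrier (F i)" "inv\<^bsub>F i\<^esub> p i x \<otimes>\<^bsub>F i\<^esub> p i x = \<one>\<^bsub>F i\<^esub>"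
      using field.field_Units[OF field[OF i]] proj_simps(1)[OF i xR] x(2)
        monoid.Units_inv_closed[OF ring.is_monoid[OF comp_ring[OF i]]]
        monoid.Units_l_inv[OF ring.is_monoid[OF comp_ring[OF i]]] by auto
    have "\<exists>y\<in>carrier R. \<forall>j<n. p j y = (if j = i then inv\<^bsub>F i\<^esub> p i x else \<zero>\<^bsub>F j\<^esub>)"
      using inv(1) by (intro proj_surj) (auto simp: comp_simps)
    then obtain y where y: "y \<in> carrier R"
      "\<And>j. j < n \<Longrightarrow> p j y = (if j = i then inv\<^bsub>F i\<^esub> p i x else \<zero>\<^bsub>F j\<^esub>)" by blast
    have "y \<otimes> x = idem {i}"
      by (rule proj_inj)
        (use y xR inv in \<open>auto simp: idem proj_simps comp_simps\<close>)
    moreover have "y \<otimes> x \<in> J" by (rule ideal.I_l_closed[OF J x(1) y(1)])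
    moreover have "idem (insert i A) = idem A \<oplus> idem {i}"
      by (rule proj_inj)
        (use insert in \<open>auto simp: idem proj_simps comp_simps\<close>)
    ultimately show ?case
      using insert additive_subgroup.a_closed[OF ideal.axioms(1)[OF J]] by simp
  qed
qed

text \<open>An element \<open>z\<close> that vanishes outside the joint support of \<open>J\<close>
  is unchanged by multiplication with the idempotent of that support, which belongs to
  \<open>J\<close>.\<close>

lemma ideal_eq_coord_ideal:
  assumes J: "ideal J R"
  shows "J = coord_ideal {i. i < n \<and> (\<exists>x\<in>J. p i x \<noteq> \<zero>\<^bsub>F i\<^esub>)}" (is "J = coord_ideal ?A")
proof
  show "J \<subseteq> coord_ideal ?A" using ideal.Icarr[OF J] by (auto simp: coord_ideal_def)
  show "coord_ideal ?A \<subseteq> J"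
  proof
    fix z assume z: "z \<in> coord_ideal ?A"
    then have zR: "z \<in> carrier R" by (simp add: coord_ideal_def)
    have "z = z \<otimes> idem ?A"
    proof (rule proj_inj)
      fix i assume i: "i < n"
      show "p i z = p i (z \<otimes> idem ?A)"
        using z i by (auto simp: coord_ideal_def proj_simps idem comp_simps)
    qed (auto simp: zR idem)
    then show "z \<in> J" using ideal.I_l_closed[OF J idem_mem_ideal[OF J order_refl] zR] by simp
  qed
qed

lemma coord_ideal_eq_iff:
  "A \<subseteq> {..<n} \<Longrightarrow> B \<subseteq> {..<n} \<Longrightarrow> coord_ideal A = coord_ideal B \<longleftrightarrow> A = B"
  using coord_ideal_subset_iff[of A B] coord_ideal_subset_iff[of B A] by auto

lemma coord_ideal_empty: "coord_ideal {} = {\<zero>}"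
  using proj_inj[OF _ zero_closed] by (auto simp: coord_ideal_def proj_simps)

lemma coord_ideal_full: "coord_ideal {..<n} = carrier R"
  by (auto simp: coord_ideal_def)

lemma nontrivial_ideals_eq:
  "nontrivial_ideals R = coord_ideal ` {A. A \<noteq> {} \<and> A \<subset> {..<n}}"
proof -
  have ideals: "ideal J R \<longleftrightarrow> (\<exists>A\<subseteq>{..<n}. J = coord_ideal A)" for J
  proof
    assume "ideal J R"
    from ideal_eq_coord_ideal[OF this] show "\<exists>A\<subseteq>{..<n}. J = coord_ideal A"
      by (intro exI[of _ "{i. i < n \<and> (\<exists>x\<in>J. p i x \<noteq> \<zero>\<^bsub>F i\<^esub>)}"]) auto
  qed (auto intro: ideal_coord_ideal)
  have eq: "coord_ideal A = {\<zero>} \<longleftrightarrow> A = {}" "coord_ideal A = carrier R \<longleftrightarrow> A = {..<n}"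
    if "A \<subseteq> {..<n}" for A
    using coord_ideal_eq_iff[OF that, of "{}"] coord_ideal_eq_iff[OF that, of "{..<n}"]
    by (simp_all add: coord_ideal_empty coord_ideal_full)
  have "J \<in> nontrivial_ideals R \<longleftrightarrow> (\<exists>A. A \<subset> {..<n} \<and> A \<noteq> {} \<and> J = coord_ideal A)" for J
    unfolding nontrivial_ideals_def psubset_eq mem_Collect_eq ideals using eq by metis
  then show ?thesis by auto
qed

end

section \<open>Short distances in a simple graph\<close>

context pair_wf_digraph
begin

lemma graph_dist_eqI:
  assumes "awalk u w v" and "\<And>q. awalk u q v \<Longrightarrow> length w \<le> length q"
  shows "graph_dist G u v = ereal (length w)"
proof -
  have cost: "awalk_cost (\<lambda>_. 1) q = length q" for q :: "('a \<times> 'a) list"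
    by (induct q) (auto simp: awalk_cost_def)
  show ?thesis
    unfolding graph_dist_def \<mu>_def cost
    by (rule INF_eqI) (use assms in auto)
qed

text \<open>Arcs are peeled off one at a time: the empty walk would give \<open>u = v\<close>, a
  single arc would join \<open>u\<close> to \<open>v\<close>, and two arcs would pass through a
  common neighbour.\<close>

lemma awalk_length:
  assumes "awalk u q v" and "u \<noteq> v"
  shows awalk_length_ge_1: "1 \<le> length q"
    and awalk_length_ge_2: "(u, v) \<notin> parcs G \<Longrightarrow> 2 \<le> length q"
    and awalk_length_ge_3: "(u, v) \<notin> parcs G \<Longrightarrow>
      (\<And>w. (u, w) \<in> parcs G \<Longrightarrow> (w, v) \<notin> parcs G) \<Longrightarrow> 3 \<le> length q"
proof -
  obtain e q1 where q: "q = e # q1" using assms by (cases q) (auto simp: awalk_def)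
  show "1 \<le> length q" using q by simp
  show ge_2: "2 \<le> length q" if "(u, v) \<notin> parcs G"
    using assms q that by (cases q1; cases e) (auto simp: awalk_def)
  assume *: "(u, v) \<notin> parcs G" "\<And>w. (u, w) \<in> parcs G \<Longrightarrow> (w, v) \<notin> parcs G"
  with ge_2 q obtain e' q2 where "q1 = e' # q2" by (cases q1) auto
  with * q assms show "3 \<le> length q" by (cases q2; cases e; cases e') (auto simp: awalk_def)
qed

lemma graph_dist_1:
  assumes "u \<noteq> v" "(u, v) \<in> parcs G"
  shows "graph_dist G u v = 1"
proof -
  have "awalk u [(u, v)] v" using assms arc_fst_in_verts by (force simp: awalk_def)
  from graph_dist_eqI[OF this] show ?thesis using assms awalk_length_ge_1 by simp
qed

lemma graph_dist_2:
  assumes "u \<noteq> v" "(u, v) \<notin> parcs G" "(u, w) \<in> parcs G" "(w, v) \<in> parcs G"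
  shows "graph_dist G u v = 2"
proof -
  have "awalk u [(u, w), (w, v)] v" using assms arc_fst_in_verts by (force simp: awalk_def)
  from graph_dist_eqI[OF this] show ?thesis
    using assms awalk_length_ge_2 by (simp add: numeral_2_eq_2[symmetric])
qed

lemma graph_dist_3:
  assumes "u \<noteq> v" "(u, v) \<notin> parcs G" "\<And>w. (u, w) \<in> parcs G \<Longrightarrow> (w, v) \<notin> parcs G"
    and "(u, x) \<in> parcs G" "(x, y) \<in> parcs G" "(y, v) \<in> parcs G"
  shows "graph_dist G u v = 3"
proof -
  have "awalk u [(u, x), (x, y), (y, v)] v" using assms arc_fst_in_verts by (force simp: awalk_def)
  from graph_dist_eqI[OF this] show ?thesis
    using assms awalk_length_ge_3 by (simp add: numeral_3_eq_3[symmetric])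
qed

end

section \<open>The inclusion graph of proper nonempty subsets\<close>

definition proper_subsets :: "nat \<Rightarrow> nat set set"
  where "proper_subsets n = {A. A \<noteq> {} \<and> A \<subset> {..<n}}"

lemma card_proper_subsets:
  assumes "n > 0"
  shows "card (proper_subsets n) = 2 ^ n - 2"
proof -
  have "proper_subsets n = Pow {..<n} - {{}, {..<n}}" by (auto simp: proper_subsets_def)
  moreover have "card {{}, {..<n}} = 2" using assms by (subst card_2_iff) auto
  ultimately show ?thesis by (simp add: card_Diff_subset card_Pow)
qed

lemma finite_proper_subsets: "finite (proper_subsets n)"
  by (rule finite_subset[of _ "Pow {..<n}"]) (auto simp: proper_subsets_def)

text \<open>\<open>\<Phi>\<close> is an isomorphism from the comparability graph of the proper
  nonempty subsets onto \<open>G\<close>. Distances can thus be computed with sets alone;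
  \<open>coord_ideal\<close> is the intended instance.\<close>

locale subset_graph = pair_wf_digraph G for G :: "'v pair_pre_digraph" +
  fixes n :: nat and \<Phi> :: "nat set \<Rightarrow> 'v"
  assumes n_ge: "n \<ge> 3"
    and inj: "inj_on \<Phi> (proper_subsets n)"
    and pverts: "pverts G = \<Phi> ` proper_subsets n"
    and parcs: "A \<in> proper_subsets n \<Longrightarrow> B \<in> proper_subsets n \<Longrightarrow>
      (\<Phi> A, \<Phi> B) \<in> parcs G \<longleftrightarrow> A \<subset> B \<or> B \<subset> A"
begin

lemma \<Phi>_eq_iff:
  "A \<in> proper_subsets n \<Longrightarrow> B \<in> proper_subsets n \<Longrightarrow> \<Phi> A = \<Phi> B \<longleftrightarrow> A = B"
  using inj by (auto simp: inj_on_def)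

text \<open>A common neighbour of two complementary sets cannot exist: inside both it would be
  empty, around both it would be everything, and between them it would make one contain the other.
  The walk of length 3 needs a third index, hence \<open>n \<ge> 3\<close>.\<close>

lemma dist_complement:
  assumes A: "A \<in> proper_subsets n"
  shows "graph_dist G (\<Phi> A) (\<Phi> ({..<n} - A)) = 3"
proof -
  define B where "B = {..<n} - A"
  have B: "B \<in> proper_subsets n" using A by (auto simp: proper_subsets_def B_def)
  have no_mid: "(w, \<Phi> B) \<notin> parcs G" if w: "(\<Phi> A, w) \<in> parcs G" for w
  proof -
    from arc_snd_in_verts[OF w] obtain C where C: "C \<in> proper_subsets n" "w = \<Phi> C"
      by (auto simp: pverts)
    with w have "A \<subset> C \<or> C \<subset> A" using parcs[OF A C(1)] by simp
    moreover have "A \<inter> B = {}" "A \<union> B = {..<n}" "A \<noteq> {}" "B \<noteq> {}" "C \<noteq> {}" "C \<subset> {..<n}"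
      using A B C(1) by (auto simp: proper_subsets_def B_def)
    ultimately have "\<not> (C \<subset> B \<or> B \<subset> C)" by blast
    then show ?thesis using parcs[OF C(1) B] C(2) by simp
  qed
  have "\<exists>C\<in>proper_subsets n. \<exists>D\<in>proper_subsets n.
    (A \<subset> C \<or> C \<subset> A) \<and> (C \<subset> D \<or> D \<subset> C) \<and> (D \<subset> B \<or> B \<subset> D)"
  proof -
    obtain a b where a: "a \<in> A" and b: "b \<in> B"
      using A B by (auto simp: proper_subsets_def)
    \<comment> \<open>The third index \<open>c\<close> makes the inclusions strict. If it lies in
      \<open>A\<close>, then \<open>{a}\<close> is strictly inside \<open>A\<close> and
      \<open>insert a B\<close> misses \<open>c\<close>; otherwise \<open>insert b A\<close> misses
      \<open>c\<close> and \<open>{b}\<close> is strictly inside \<open>B\<close>.\<close>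
    have "\<exists>c<n. c \<noteq> a \<and> c \<noteq> b" using n_ge by presburger
    then obtain c where c: "c < n" "c \<noteq> a" "c \<noteq> b" by blast
    show ?thesis
    proof (cases "c \<in> A")
      case True
      show ?thesis
        by (rule bexI[of _ "{a}"], rule bexI[of _ "insert a B"])
          (use True a b c A in \<open>auto simp: proper_subsets_def B_def\<close>)
    next
      case False
      show ?thesis
        by (rule bexI[of _ "insert b A"], rule bexI[of _ "{b}"])
          (use False a b c A in \<open>auto simp: proper_subsets_def B_def\<close>)
    qed
  qed
  then obtain C D where "C \<in> proper_subsets n" "D \<in> proper_subsets n"
    "A \<subset> C \<or> C \<subset> A" "C \<subset> D \<or> D \<subset> C" "D \<subset> B \<or> B \<subset> D" by blast
  moreover have "A \<noteq> B" "\<not> A \<subset> B" "\<not> B \<subset> A" using A B by (auto simp: proper_subsets_def B_def)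
  ultimately have "graph_dist G (\<Phi> A) (\<Phi> B) = 3"
    using A B parcs no_mid \<Phi>_eq_iff by (intro graph_dist_3[of _ _ "\<Phi> C" "\<Phi> D"]) auto
  then show ?thesis by (simp add: B_def)
qed

lemma dist_eq:
  assumes A: "A \<in> proper_subsets n" and B: "B \<in> proper_subsets n" and "A \<noteq> B"
  shows "graph_dist G (\<Phi> A) (\<Phi> B) =
    (if A \<subset> B \<or> B \<subset> A then 1 else if B = {..<n} - A then 3 else 2)"
proof -
  have ne: "\<Phi> A \<noteq> \<Phi> B" using assms \<Phi>_eq_iff by simp
  consider (comparable) "A \<subset> B \<or> B \<subset> A" | (complement) "B = {..<n} - A" "\<not> (A \<subset> B \<or> B \<subset> A)"
    | (other) "B \<noteq> {..<n} - A" "\<not> (A \<subset> B \<or> B \<subset> A)" by blast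
  then show ?thesis
  proof cases
    case comparable
    then show ?thesis using graph_dist_1[OF ne] parcs A B by auto
  next
    case complement
    then show ?thesis using dist_complement[OF A] by simp
  next
    case other
    \<comment> \<open>A common neighbour: the union of disjoint sets is proper because they are not
      complementary, and a nonempty intersection is strictly inside both because they are
      incomparable.\<close>
    define C where "C = (if A \<inter> B = {} then A \<union> B else A \<inter> B)"
    have "C \<in> proper_subsets n" "A \<subset> C \<or> C \<subset> A" "C \<subset> B \<or> B \<subset> C"
      using other A B \<open>A \<noteq> B\<close> by (auto simp: proper_subsets_def C_def)
    then have "graph_dist G (\<Phi> A) (\<Phi> B) = 2"
      using ne other parcs A B by (intro graph_dist_2[of _ _ "\<Phi> C"]) auto
    then show ?thesis using other by simp
  qed
qed

section \<open>Lower bound: counting representation vectors\<close>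

text \<open>The summands on the right count the vectors over \<open>{1, 2}\<close>, the members of
  \<open>S\<close> together with their complements, and the two subsets that are not
  vertices.\<close>

lemma resolving_length_bound:
  assumes S: "resolving G S"
  shows "2 ^ n \<le> 2 ^ length S + 2 * length S + 2"
proof -
  let ?V = "\<Phi> ` proper_subsets n" and ?D = "\<lambda>v. representation_vector G v S"
  let ?k = "length S"
  \<comment> \<open>Complementation of index sets, carried over to vertices.\<close>
  let ?co = "\<lambda>v. \<Phi> ({..<n} - the_inv_into (proper_subsets n) \<Phi> v)"
  define L :: "ereal list set" where "L = {xs. set xs \<subseteq> {1, 2} \<and> length xs = ?k}"
  have SV: "set S \<subseteq> ?V" and inj_D: "inj_on ?D (?V - set S)"
    using S unfolding resolving_def inj_on_def pverts with_proj_simps by blast+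
  have L: "finite L" "card L = 2 ^ ?k"
    unfolding L_def
    by (simp_all add: finite_lists_length_eq card_lists_length_eq numeral_2_eq_2)
  \<comment> \<open>Distances between distinct vertices are 1, 2 or 3, so a vector outside
    \<open>L\<close> has an entry 3, which occurs only for complements.\<close>
  have "v \<in> (?V - set S) \<inter> ?D -` L \<or> v \<in> ?co ` set S" if v: "v \<in> ?V - set S" for v
  proof (cases "?D v \<in> L")
    case False
    obtain A where A: "A \<in> proper_subsets n" "v = \<Phi> A" using v by auto
    obtain s where s: "s \<in> set S" "graph_dist G v s \<notin> {1, 2}"
      using False by (auto simp: L_def representation_vector_def)
    then obtain B where B: "B \<in> proper_subsets n" "s = \<Phi> B" using SV by auto
    have "A \<noteq> B" using A B s v by auto
    with dist_eq[OF A(1) B(1)] A B s have "B = {..<n} - A" by (auto split: if_splits)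
    then have "{..<n} - B = A" using A by (auto simp: proper_subsets_def)
    then have "v = ?co s" using A B inj by (simp add: the_inv_into_f_f)
    then show ?thesis using s by blast
  qed (use v in simp)
  then have "?V \<subseteq> set S \<union> (?V - set S) \<inter> ?D -` L \<union> ?co ` set S" by blast
  moreover have fin: "finite ((?V - set S) \<inter> ?D -` L)" using finite_proper_subsets by auto
  ultimately have "card ?V \<le> card (set S \<union> (?V - set S) \<inter> ?D -` L \<union> ?co ` set S)"
    by (intro card_mono) auto
  also have "\<dots> \<le> card (set S) + card ((?V - set S) \<inter> ?D -` L) + card (?co ` set S)"
    by (meson card_Un_le add_mono order_refl order_trans)
  \<comment> \<open>This is where resolving is used: vertices outside \<open>S\<close> are
    determined by their vectors.\<close>
  also have "card ((?V - set S) \<inter> ?D -` L) \<le> card L"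
    using L inj_D by (intro card_inj_on_le[of ?D]) (auto intro: inj_on_subset)
  also have "card (?co ` set S) \<le> ?k" using card_image_le card_length by (metis List.finite_set order_trans)
  also have "card (set S) \<le> ?k" by (rule card_length)
  finally have "2 ^ n - 2 \<le> 2 ^ ?k + 2 * ?k"
    using L card_image[OF inj] card_proper_subsets[of n] n_ge by simp
  then show ?thesis by simp
qed

section \<open>Upper bound: resolving sets of singletons\<close>

definition singletons :: "nat \<Rightarrow> 'v list"
  where "singletons m = map (\<lambda>i. \<Phi> {i}) [0..<m]"

lemma singleton_proper:
  assumes "i < n"
  shows "{i} \<in> proper_subsets n"
proof -
  have "card {i} \<noteq> card {..<n}" using n_ge by simp
  then have "{i} \<noteq> {..<n}" by metis
  with assms show ?thesis by (simp add: proper_subsets_def psubset_eq)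
qed

text \<open>Reduces resolving to a statement about sets, with \<open>m\<close> left open so that it
  serves both \<open>n\<close> and \<open>n - 1\<close> singletons.\<close>

lemma resolving_singletonsI:
  assumes "m \<le> n"
    and "\<And>A B. A \<in> proper_subsets n \<Longrightarrow> B \<in> proper_subsets n \<Longrightarrow>
      (\<And>i. i < m \<Longrightarrow> A \<noteq> {i} \<and> B \<noteq> {i}) \<Longrightarrow>
      (\<And>i. i < m \<Longrightarrow> graph_dist G (\<Phi> A) (\<Phi> {i}) = graph_dist G (\<Phi> B) (\<Phi> {i})) \<Longrightarrow> A = B"
  shows "resolving G (singletons m)"
  unfolding resolving_def
proof (intro conjI ballI impI notI)
  show "distinct (singletons m)"
    using assms(1) by (auto simp: singletons_def distinct_map inj_on_def \<Phi>_eq_iff singleton_proper)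
  show "set (singletons m) \<subseteq> verts G"
    using assms(1) by (auto simp: singletons_def pverts singleton_proper)
  fix u v
  assume u: "u \<in> verts G - set (singletons m)" and v: "v \<in> verts G - set (singletons m)"
    and uv: "u \<noteq> v" "representation_vector G u (singletons m) = representation_vector G v (singletons m)"
  obtain A B where "A \<in> proper_subsets n" "u = \<Phi> A" "B \<in> proper_subsets n" "v = \<Phi> B"
    using u v by (auto simp: pverts)
  note AB = this
  have "A = B"
  proof (rule assms(2)[OF AB(1,3)])
    show "A \<noteq> {i} \<and> B \<noteq> {i}" if "i < m" for i
      using u v AB that by (auto simp: singletons_def)
    show "graph_dist G (\<Phi> A) (\<Phi> {i}) = graph_dist G (\<Phi> B) (\<Phi> {i})" if "i < m" for i
      using uv(2) AB that by (auto simp: singletons_def representation_vector_def)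
  qed
  then show False using uv AB by simp
qed

text \<open>A nonempty set other than \<open>{i}\<close> is comparable with \<open>{i}\<close>
  exactly when it contains \<open>i\<close>.\<close>

lemma mem_iff_dist_singleton:
  assumes "A \<in> proper_subsets n" "i < n" "A \<noteq> {i}"
  shows "i \<in> A \<longleftrightarrow> graph_dist G (\<Phi> A) (\<Phi> {i}) = 1"
  using dist_eq[OF assms(1) singleton_proper[OF assms(2)] assms(3)] assms
  by (auto simp: proper_subsets_def)

lemma resolving_all_singletons: "resolving G (singletons n)"
proof (rule resolving_singletonsI)
  fix A B
  assume AB: "A \<in> proper_subsets n" "B \<in> proper_subsets n" "\<And>i. i < n \<Longrightarrow> A \<noteq> {i} \<and> B \<noteq> {i}"
    "\<And>i. i < n \<Longrightarrow> graph_dist G (\<Phi> A) (\<Phi> {i}) = graph_dist G (\<Phi> B) (\<Phi> {i})"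
  then have "i \<in> A \<longleftrightarrow> i \<in> B" if "i < n" for i
    using mem_iff_dist_singleton that by simp
  with AB show "A = B" by (auto simp: proper_subsets_def)
qed simp

text \<open>Let \<open>i\<close> be an index missing from \<open>A\<close>. Then \<open>B\<close>
  has at least two elements, all among the \<open>n - 2\<close> indices below \<open>n - 1\<close>
  other than \<open>i\<close>. As \<open>n - 2 \<le> 2\<close>, it contains all of them, so
  \<open>A\<close> is the complement of \<open>{i}\<close>.\<close>

lemma dist_omitted_neq:
  assumes "n \<le> 4" and A: "A \<in> proper_subsets n" "n - 1 \<in> A"
    and B: "B = A - {n - 1}" "B \<in> proper_subsets n"
    and ns: "\<And>i. i < n - 1 \<Longrightarrow> B \<noteq> {i}"
  obtains i where "i < n - 1" "graph_dist G (\<Phi> A) (\<Phi> {i}) = 3" "graph_dist G (\<Phi> B) (\<Phi> {i}) = 2"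
proof -
  obtain i where i: "i < n" "i \<notin> A" using A by (auto simp: proper_subsets_def)
  then have "i \<noteq> n - 1" using A by blast
  with i have i': "i < n - 1" by linarith
  have fin: "finite B" and B_sub: "B \<subseteq> {..<n - 1} - {i}"
  proof -
    have "A \<subseteq> {..<n}" using A by (auto simp: proper_subsets_def)
    moreover have "{..<n} = insert (n - 1) {..<n - 1}" using n_ge by auto
    ultimately show "B \<subseteq> {..<n - 1} - {i}" using B i by blast
    then show "finite B" by (rule finite_subset) simp
  qed
  have "card B \<noteq> 0" "card B \<noteq> 1"
    using B ns B_sub fin by (auto simp: proper_subsets_def card_1_singleton_iff)
  moreover have "card ({..<n - 1} - {i}) \<le> 2" using \<open>n \<le> 4\<close> i' by simp
  ultimately have "B = {..<n - 1} - {i}" using B_sub by (intro card_seteq) auto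
  moreover have "{..<n} = insert (n - 1) {..<n - 1}" using n_ge by auto
  moreover have "A = insert (n - 1) B" using A B by blast
  ultimately have "A = {..<n} - {i}" using i' by auto
  then have compl: "{i} = {..<n} - A" using i by auto
  have "A \<noteq> {i}" "B \<noteq> {i}" using i B by auto
  have "graph_dist G (\<Phi> A) (\<Phi> {i}) = 3"
    using dist_complement[OF A(1)] compl by simp
  \<comment> \<open>The index \<open>n - 1\<close> lies in neither \<open>B\<close> nor
    \<open>{i}\<close>, so these are not complementary; they are incomparable because
    \<open>B\<close> is nonempty and misses \<open>i\<close>.\<close>
  moreover have "graph_dist G (\<Phi> B) (\<Phi> {i}) = 2"
  proof -
    have "n - 1 \<in> {..<n} - B" "n - 1 \<noteq> i" using n_ge B i' by auto
    then have "{i} \<noteq> {..<n} - B" by blast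
    moreover have "B \<noteq> {}" "i \<notin> B" using B i by (auto simp: proper_subsets_def)
    then have "\<not> B \<subset> {i}" "\<not> {i} \<subset> B" by blast+
    ultimately show ?thesis
      using dist_eq[OF B(2) singleton_proper[OF i(1)] \<open>B \<noteq> {i}\<close>] by simp
  qed
  ultimately show ?thesis using that i' by blast
qed

lemma resolving_singletons_pred:
  assumes "n \<le> 4"
  shows "resolving G (singletons (n - 1))"
proof (rule resolving_singletonsI)
  fix A B
  assume AB: "A \<in> proper_subsets n" "B \<in> proper_subsets n"
    and ns: "\<And>i. i < n - 1 \<Longrightarrow> A \<noteq> {i} \<and> B \<noteq> {i}"
    and dist: "\<And>i. i < n - 1 \<Longrightarrow> graph_dist G (\<Phi> A) (\<Phi> {i}) = graph_dist G (\<Phi> B) (\<Phi> {i})"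
  have same: "i \<in> A \<longleftrightarrow> i \<in> B" if "i < n - 1" for i
    using mem_iff_dist_singleton AB ns dist that by simp
  have sub: "i < n - 1 \<or> i = n - 1" if "i \<in> A \<union> B" for i
    using AB that by (auto simp: proper_subsets_def)
  \<comment> \<open>The sets agree below \<open>n - 1\<close>, so they can differ only in
    \<open>n - 1\<close>; the first two cases contradict \<open>dist_omitted_neq\<close>.\<close>
  consider "n - 1 \<in> A" "n - 1 \<notin> B" | "n - 1 \<notin> A" "n - 1 \<in> B" | "n - 1 \<in> A \<longleftrightarrow> n - 1 \<in> B" by blast
  then show "A = B"
  proof cases
    case 1
    then have "B = A - {n - 1}" using same sub by blast
    from dist_omitted_neq[OF assms AB(1) 1(1) this AB(2)] ns dist show ?thesis by force
  next
    case 2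
    then have "A = B - {n - 1}" using same sub by blast
    from dist_omitted_neq[OF assms AB(2) 2(2) this AB(1)] ns dist show ?thesis by force
  next
    case 3
    then show ?thesis using same sub by blast
  qed
qed simp

section \<open>The value of the metric dimension\<close>

text \<open>The second hypothesis is the failure of \<open>resolving_length_bound\<close> at every
  length below \<open>m\<close>.\<close>

lemma metric_dimension_eqI:
  assumes "resolving G (singletons m)"
    and "\<And>k. k < m \<Longrightarrow> 2 ^ k + 2 * k + 2 < (2 :: nat) ^ n"
  shows "metric_dimension G = enat m"
  unfolding metric_dimension_def
proof (rule antisym)
  show "(INF S\<in>{S. resolving G S}. enat (length S)) \<le> enat m"
    using assms(1) by (intro INF_lower2[of "singletons m"]) (auto simp: singletons_def)
  show "enat m \<le> (INF S\<in>{S. resolving G S}. enat (length S))"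
  proof (rule INF_greatest)
    fix S assume "S \<in> {S. resolving G S}"
    then have "2 ^ n \<le> 2 ^ length S + 2 * length S + 2" using resolving_length_bound by simp
    with assms(2)[of "length S"] show "enat m \<le> enat (length S)" by (meson enat_ord_simps(1) not_le)
  qed
qed

text \<open>The largest excluded lengths give 6 < 8 for \<open>n = 3\<close> and 10 < 16 for
  \<open>n = 4\<close>.\<close>

lemma metric_dimension_small:
  assumes "n \<le> 4"
  shows "metric_dimension G = enat (n - 1)"
proof (rule metric_dimension_eqI[OF resolving_singletons_pred[OF assms]])
  fix k assume "k < n - 1"
  with assms n_ge have "n = 3 \<and> k < 2 \<or> n = 4 \<and> k < 3" by linarith
  then consider "n = 3" "k = 0" | "n = 3" "k = 1" | "n = 4" "k = 0" | "n = 4" "k = 1" | "n = 4" "k = 2"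
    by linarith
  then show "2 ^ k + 2 * k + 2 < (2 :: nat) ^ n"
    by cases simp_all
qed

lemma metric_dimension_large:
  assumes "n \<ge> 5"
  shows "metric_dimension G = enat n"
proof (rule metric_dimension_eqI[OF resolving_all_singletons])
  fix k assume k: "k < n"
  \<comment> \<open>Used at \<open>m = n - 1\<close>, where the left side is
    \<open>2 * n + 2\<close>. The induction starts with 12 < 16 at \<open>m = 4\<close>, that is, at
    \<open>n = 5\<close>.\<close>
  have "2 * m + 4 < (2 :: nat) ^ m" if "4 \<le> m" for m
    using that by (induct m rule: dec_induct) auto
  from this[of "n - 1"] assms have "2 * (n - 1) + 4 < (2 :: nat) ^ (n - 1)" by simp
  then have "2 * n + 2 < (2 :: nat) ^ (n - 1)" using assms by linarith
  moreover have "(2 :: nat) ^ n = 2 * 2 ^ (n - 1)" using assms by (cases n) auto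
  moreover have "(2 :: nat) ^ k \<le> 2 ^ (n - 1)" using k by (intro power_increasing) auto
  ultimately show "2 ^ k + 2 * k + 2 < (2 :: nat) ^ n" using k by linarith
qed

end

section \<open>Transfer to the ideals of a product ring\<close>

lemma (in field_product) subset_graph_inclusion_ideal_graph:
  assumes "n \<ge> 3"
  shows "subset_graph (inclusion_ideal_graph R) n coord_ideal"
proof -
  interpret G: pair_bidirected_digraph "inclusion_ideal_graph R"
    by (rule pair_bidirected_digraph_inclusion_ideal_graph)
  have psub: "coord_ideal A \<subset> coord_ideal B \<longleftrightarrow> A \<subset> B"
    if "A \<in> proper_subsets n" "B \<in> proper_subsets n" for A B
    using that coord_ideal_subset_iff[of A B] coord_ideal_subset_iff[of B A]
    by (auto simp: proper_subsets_def less_le_not_le)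
  have ideals: "nontrivial_ideals R = coord_ideal ` proper_subsets n"
    unfolding nontrivial_ideals_eq proper_subsets_def ..
  show ?thesis
  proof
    show "inj_on coord_ideal (proper_subsets n)"
      by (rule inj_onI) (simp add: coord_ideal_eq_iff proper_subsets_def psubset_eq)
    show "pverts (inclusion_ideal_graph R) = coord_ideal ` proper_subsets n"
      by (simp add: inclusion_ideal_graph_def ideals)
    fix A B assume "A \<in> proper_subsets n" "B \<in> proper_subsets n"
    then show "(coord_ideal A, coord_ideal B) \<in> parcs (inclusion_ideal_graph R) \<longleftrightarrow> A \<subset> B \<or> B \<subset> A"
      by (simp add: inclusion_ideal_graph_def ideals psub)
  qed (rule assms)
qed

text \<open>The projections are the list entries after \<open>h\<close>. Prescribed values form a
  list in the carrier, and carrier lists all have length \<open>n\<close>, so equal entries force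
  equal lists.\<close>

lemma field_product_RDirProd_list:
  assumes "\<And>i. i < n \<Longrightarrow> field (F i)" and "cring R" and "h \<in> ring_iso R (RDirProd_list (map F [0..<n]))"
  shows "field_product R n F (\<lambda>i x. h x ! i)"
proof -
  let ?P = "RDirProd_list (map F [0..<n])"
  have h: "h \<in> ring_hom R ?P" "bij_betw h (carrier R) (carrier ?P)"
    using assms(3) by (auto simp: ring_iso_def)
  show ?thesis
  proof (intro field_product.intro field_product_axioms.intro assms(2))
    fix i assume i: "i < n"
    then show "field (F i)" by (rule assms(1))
    have "(\<lambda>xs. xs ! i) \<in> ring_hom ?P (F i)" using RDirProd_list_nth_hom[of i "map F [0..<n]"] i by simp
    from ring_hom_trans[OF h(1) this] show "(\<lambda>x. h x ! i) \<in> ring_hom R (F i)" by (simp add: comp_def)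
  next
    fix f assume f: "\<And>i. i < n \<Longrightarrow> f i \<in> carrier (F i)"
    have "map f [0..<n] \<in> carrier ?P" using f by (intro RDirProd_list_carrier_memI) auto
    then obtain x where "x \<in> carrier R" "h x = map f [0..<n]" using h(2) by (metis bij_betw_iff_bijections)
    then show "\<exists>x\<in>carrier R. \<forall>i<n. h x ! i = f i" by (intro bexI[of _ x]) simp_all
  next
    fix x y assume x: "x \<in> carrier R" and y: "y \<in> carrier R" and eq: "\<And>i. i < n \<Longrightarrow> h x ! i = h y ! i"
    have "length (h x) = n" "length (h y) = n"
      using RDirProd_list_carrier_mem(1) ring_hom_closed[OF h(1)] x y by fastforce+
    then have "h x = h y" using eq by (auto intro: nth_equalityI)
    then show "x = y" using h(2) x y by (auto simp: bij_betw_def inj_on_def)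
  qed
qed

theorem theorem2p1:
  fixes n :: nat and F :: "nat \<Rightarrow> 'a ring" and R :: "('b, 'm) ring_scheme"
  assumes "n \<ge> 3"
    and "\<And>i. 1 \<le> i \<Longrightarrow> i \<le> n \<Longrightarrow> field (F i)"
    and "cring R"
    and "R \<simeq> RDirProd_list (map F [1..<n + 1])"
  shows "(n \<le> 4 \<longrightarrow> metric_dimension (inclusion_ideal_graph R) = enat (n - 1)) \<and>
         (n \<ge> 5 \<longrightarrow> metric_dimension (inclusion_ideal_graph R) = enat n)"
proof -
  \<comment> \<open>Shifts the indices from 1 up to \<open>n\<close> to the range from 0 used by
    \<open>field_product\<close>.\<close>
  have "map F [1..<n + 1] = map (\<lambda>i. F (Suc i)) [0..<n]"
    by (simp add: map_Suc_upt[symmetric] comp_def del: upt_Suc)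
  with assms(4) obtain h where "h \<in> ring_iso R (RDirProd_list (map (\<lambda>i. F (Suc i)) [0..<n]))"
    by (auto simp: is_ring_iso_def)
  then interpret field_product R n "\<lambda>i. F (Suc i)" "\<lambda>i x. h x ! i"
    using assms(2,3) by (intro field_product_RDirProd_list) auto
  interpret subset_graph "inclusion_ideal_graph R" n coord_ideal
    using assms(1) by (rule subset_graph_inclusion_ideal_graph)
  show ?thesis using metric_dimension_small metric_dimension_large by blast
qed

end
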